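(* For each $N$ let $\widehat{\mathbf A}_{\mathcal S,n}=\mathsf f_n(\mathbf Y_n)$, $n=1,2,\dots$, be a matrix estimator for which there is a limiting matrix estimator $\widehat{\mathbf A}_{\mathcal S}=\mathsf h(\mathbf A)$ (a deterministic function of $\mathbf A$) such that, for every $N$ and every $\epsilon>0$, $$\lim_{n\to\infty}\mathbb P\big[\|\widehat{\mathbf A}_{\mathcal S,n}-\widehat{\mathbf A}_{\mathcal S}\|_{\max}>\epsilon\big]=0 .$$ Assume that the limiting matrix estimator $\widehat{\mathbf A}_{\mathcal S}$ achieves universal local structural consistency. Let $\mathbf G_{\mathcal S}$ be the (random) support graph associated to $\mathbf A_{\mathcal S}$ and let $\widehat{\mathbf G}_{\mathcal S,n}=\mathsf{clu}(\widehat{\mathbf A}_{\mathcal S,n})$ be the subgraph estimated by the clustering algorithm $\mathsf{clu}$. Then there exists a scaling law $n(N)$ such that $$\lim_{N\to\infty}\mathbb P\big[\widehat{\mathbf G}_{\mathcal S,n(N)}=\mathbf G_{\mathcal S}\big]=1 .$$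
   Context: **Model.** For each $N$, the node set is $\mathcal N=\{1,\dots,N\}$ and $\mathbf G$ is the adjacency matrix of an undirected Erdős–Rényi graph $\mathscr G(N,p_N)$: the $\mathbf g_{ij}$, $i<j$, are independent Bernoulli variables with success probability $p_N$, and $\mathbf g_{ji}=\mathbf g_{ij}$. The combination matrix $\mathbf A=\pi(\mathbf G)$ is a deterministic function of $\mathbf G$; it is an $N\times N$ stable matrix with nonnegative entries $\mathbf a_{ij}$. The data follow $\mathbf y_n=\mathbf A\mathbf y_{n-1}+\sigma\mathbf x_n$, where the input entries $\mathbf x_i(n)$ are i.i.d. over $i$ and $n$, with zero mean and unit variance, independent of $\mathbf G$. Only a subset $\mathcal S=\mathcal S_N\subset\mathcal N$ of nodes is observed, with $|\mathcal S|/N\to\xi\in(0,1)$ as $N\to\infty$. $\mathbf Y_n$ is the $|\mathcal S|\times n$ matrix with entries $\mathbf y_\ell(i)$, $\ell\in\mathcal S$, $i=1,\dots,n$. A matrix estimator is a measurable map $\mathsf f_n:\mathbb R^{|\mathcal S|\times n}\to\mathbb R^{|\mathcal S|\times|\mathcal S|}$ applied to $\mathbf Y_n$. $\mathbf A_{\mathcal S}$ is the submatrix of $\mathbf A$ with rows and columns in $\mathcal S$ (entries keep their original indices). $\mathbf G_{\mathcal S}$ has off-diagonal entries equal to $1$ if $\mathbf a_{ij}>0$ and $0$ if $\mathbf a_{ij}=0$, and its main diagonal is conventionally set to $0$. $\|M\|_{\max}$ is the maximum absolute entry of $M$. **Margins.** For an estimator $\widehat{\mathbf A}_{\mathcal S}$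 with entries $\widehat{\mathbf a}_{ij}$, let $\underline{\boldsymbol\delta}_N$ and $\overline{\boldsymbol\delta}_N$ be the minimum and the maximum of $\widehat{\mathbf a}_{ij}$ over $i,j\in\mathcal S$, $i\ne j$, $\mathbf a_{ij}=0$; let $\underline{\boldsymbol\Delta}_N$ and $\overline{\boldsymbol\Delta}_N$ be the minimum and the maximum of $\widehat{\mathbf a}_{ij}$ over $i,j\in\mathcal S$, $i\neq j$, $\mathbf a_{ij}>0$. If all pairs in $\mathcal S$ are connected, or all are disconnected, the undefined margins are given arbitrary values; it is a standing assumption that the probability of these degenerate events tends to $0$ as $N\to\infty$. **Universal local structural consistency.** $\widehat{\mathbf A}_{\mathcal S}$ achieves universal local structural consistency, with bias $\eta\in\mathbb R$, identifiability gap $\Gamma>0$ and (positive) scaling sequence $s_N$, if for every $\epsilon>0$, as $N\to\infty$, each of the four events $|s_N\underline{\boldsymbol\delta}_N-\eta|<\epsilon$, $|s_N\overline{\boldsymbol\delta}_N-\eta|<\epsilon$, $|s_N\underline{\boldsymbol\Delta}_N-(\eta+\Gamma)|<\epsilon$, $|s_N\overline{\boldsymbol\Delta}_N-(\eta+\Gamma)|<\epsilon$ has probability tending to $1$. It achieves universal local structural consistency if such $s_N,\eta,\Gamma$ exist. **Clustering algorithm $\mathsf{clu}$.** Given a matrix $M$ indexed by $\mathcal S$, arrange the off-diagonal entries $m_{ij}$ ($i,j\in\mathcal S$, $i\ne j$) in ascending order $v_1\le\dots\le v_L$. For $j\in\{1,\dots,L-1\}$ consider the partition $\mathcal C_0(j)=\{v_1,\dots,v_j\}$,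 $\mathcal C_1(j)=\{v_{j+1},\dots,v_L\}$ with centroids (arithmetic means) $c_0(j),c_1(j)$. An index $j$ is admissible if the midpoint between the centroids separates the two clusters: $v_j\le\frac{c_0(j)+c_1(j)}2\le v_{j+1}$. Among admissible indices the algorithm selects $j^\star$ maximizing $c_1(j)-c_0(j)$. The output $\widehat G=\mathsf{clu}(M)$ has zero main diagonal and, for $i\ne j$, $\widehat g_{ij}=1$ if $m_{ij}$ is assigned to $\mathcal C_1(j^\star)$ and $\widehat g_{ij}=0$ otherwise. *)

theory Defs
  imports
    "HOL-Probability.Probability"
    "Jordan_Normal_Form.Char_Poly"
begin

text \<open>
  A real matrix is a function on index pairs, so that a submatrix keeps the original
  indices and spaces of matrices are finite products of copies of the Borel space. Only the entries
  at pairs of nodes are meaningful.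
\<close>

type_synonym rmat = "nat \<times> nat \<Rightarrow> real"

definition submat :: "nat set \<Rightarrow> rmat \<Rightarrow> rmat" where
  "submat S A = restrict A (S \<times> S)"

definition stable :: "nat \<Rightarrow> rmat \<Rightarrow> bool" where
  "stable N A \<longleftrightarrow>
     (\<forall>z. eigenvalue (Matrix.mat N N (\<lambda>(i, j). complex_of_real (A (Suc i, Suc j)))) z
           \<longrightarrow> cmod z < 1)"

text \<open>The inserted \<open>0\<close> only matters for \<open>S = {}\<close>.\<close>

definition max_norm :: "nat set \<Rightarrow> rmat \<Rightarrow> real" where
  "max_norm S A = Max (insert 0 ((\<lambda>ij. \<bar>A ij\<bar>) ` (S \<times> S)))"

definition offdiag :: "nat set \<Rightarrow> (nat \<times> nat) set" where
  "offdiag S = {(i, j). i \<in> S \<and> j \<in> S \<and> i \<noteq> j}"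

text \<open>
  Only the edge variables \<open>g i j\<close> with \<open>i < j\<close> are used. The diagonal is set to \<open>0\<close>;
  as the combination matrix is an arbitrary function of the adjacency matrix, any other fixed
  convention for the diagonal would do as well.
\<close>

definition adjacency :: "nat \<Rightarrow> (nat \<Rightarrow> nat \<Rightarrow> 'a \<Rightarrow> bool) \<Rightarrow> 'a \<Rightarrow> rmat" where
  "adjacency N g \<omega> =
     (\<lambda>(i, j) \<in> {1..N} \<times> {1..N}. of_bool (i \<noteq> j \<and> g (min i j) (max i j) \<omega>))"

text \<open>
  The initial state \<open>y i 0\<close> is an arbitrary random variable.
\<close>

locale diffusion_network = prob_space M
  for M :: "'a measure" +
  fixes N :: nat
    and p :: real
    and g :: "nat \<Rightarrow> nat \<Rightarrow> 'a \<Rightarrow> bool"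
    and \<pi> :: "rmat \<Rightarrow> rmat"
    and A :: "'a \<Rightarrow> rmat"
    and \<sigma> :: real
    and x y :: "nat \<Rightarrow> nat \<Rightarrow> 'a \<Rightarrow> real"
  assumes p: "0 \<le> p" "p \<le> 1"
    and edges_indep:
      "indep_vars (\<lambda>_. count_space UNIV) (\<lambda>(i, j). g i j) {(i, j). 1 \<le> i \<and> i < j \<and> j \<le> N}"
    and edges_bernoulli:
      "\<And>i j. 1 \<le> i \<Longrightarrow> i < j \<Longrightarrow> j \<le> N \<Longrightarrow>
         distr M (count_space UNIV) (g i j) = measure_pmf (bernoulli_pmf p)"
    and combination: "\<And>\<omega>. \<omega> \<in> space M \<Longrightarrow> A \<omega> = \<pi> (adjacency N g \<omega>)"
    and A_nonneg:
      "\<And>\<omega> i j. \<omega> \<in> space M \<Longrightarrow> i \<in> {1..N} \<Longrightarrow> j \<in> {1..N} \<Longrightarrow> 0 \<le> A \<omega> (i, j)"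
    and A_stable: "\<And>\<omega>. \<omega> \<in> space M \<Longrightarrow> stable N (A \<omega>)"
    and x_indep: "indep_vars (\<lambda>_. borel) (\<lambda>(i, n). x i n) ({1..N} \<times> {1..})"
    and x_identical:
      "\<And>i n i' n'. i \<in> {1..N} \<Longrightarrow> i' \<in> {1..N} \<Longrightarrow> 1 \<le> n \<Longrightarrow> 1 \<le> n' \<Longrightarrow>
         distr M borel (x i n) = distr M borel (x i' n')"
    and x_moments:
      "\<And>i n. i \<in> {1..N} \<Longrightarrow> 1 \<le> n \<Longrightarrow>
         integrable M (x i n) \<and> integrable M (\<lambda>\<omega>. (x i n \<omega>)\<^sup>2) \<and>
         expectation (x i n) = 0 \<and> variance (x i n) = 1"
    and x_indep_graph:
      "indep_var
         (Pi\<^sub>M ({1..N} \<times> {1..}) (\<lambda>_. borel)) (\<lambda>\<omega>. \<lambda>(i, n) \<in> {1..N} \<times> {1..}. x i n \<omega>)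
         (Pi\<^sub>M ({1..N} \<times> {1..N}) (\<lambda>_. borel)) (adjacency N g)"
    and y_initial: "\<And>i. i \<in> {1..N} \<Longrightarrow> random_variable borel (y i 0)"
    and y_step:
      "\<And>\<omega> i n. \<omega> \<in> space M \<Longrightarrow> i \<in> {1..N} \<Longrightarrow> 1 \<le> n \<Longrightarrow>
         y i n \<omega> = (\<Sum>j = 1..N. A \<omega> (i, j) * y j (n - 1) \<omega>) + \<sigma> * x i n \<omega>"

definition data_matrix ::
  "nat set \<Rightarrow> (nat \<Rightarrow> nat \<Rightarrow> 'a \<Rightarrow> real) \<Rightarrow> nat \<Rightarrow> 'a \<Rightarrow> rmat" where
  "data_matrix S y n \<omega> = (\<lambda>(l, i) \<in> S \<times> {1..n}. y l i \<omega>)"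

definition matrix_estimator :: "nat set \<Rightarrow> nat \<Rightarrow> (rmat \<Rightarrow> rmat) \<Rightarrow> bool" where
  "matrix_estimator S n f \<longleftrightarrow>
     f \<in> measurable (Pi\<^sub>M (S \<times> {1..n}) (\<lambda>_. borel)) (Pi\<^sub>M (S \<times> S) (\<lambda>_. borel))"

definition support_graph :: "nat set \<Rightarrow> rmat \<Rightarrow> rmat" where
  "support_graph S A = (\<lambda>(i, j) \<in> S \<times> S. of_bool (i \<noteq> j \<and> A (i, j) > 0))"

definition disconnected_pairs :: "nat set \<Rightarrow> rmat \<Rightarrow> (nat \<times> nat) set" where
  "disconnected_pairs S A = {ij \<in> offdiag S. A ij = 0}"

definition connected_pairs :: "nat set \<Rightarrow> rmat \<Rightarrow> (nat \<times> nat) set" where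
  "connected_pairs S A = {ij \<in> offdiag S. A ij > 0}"

text \<open>
  In the degenerate cases the margins below are \<open>Min {}\<close> or \<open>Max {}\<close>, i.e. unspecified reals.
\<close>

definition \<delta>_min :: "nat set \<Rightarrow> rmat \<Rightarrow> rmat \<Rightarrow> real" where
  "\<delta>_min S A E = Min (E ` disconnected_pairs S A)"

definition \<delta>_max :: "nat set \<Rightarrow> rmat \<Rightarrow> rmat \<Rightarrow> real" where
  "\<delta>_max S A E = Max (E ` disconnected_pairs S A)"

definition \<Delta>_min :: "nat set \<Rightarrow> rmat \<Rightarrow> rmat \<Rightarrow> real" where
  "\<Delta>_min S A E = Min (E ` connected_pairs S A)"

definition \<Delta>_max :: "nat set \<Rightarrow> rmat \<Rightarrow> rmat \<Rightarrow> real" where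
  "\<Delta>_max S A E = Max (E ` connected_pairs S A)"

definition consistent_with ::
  "(nat \<Rightarrow> 'a measure) \<Rightarrow> (nat \<Rightarrow> nat set) \<Rightarrow> (nat \<Rightarrow> 'a \<Rightarrow> rmat) \<Rightarrow> (nat \<Rightarrow> 'a \<Rightarrow> rmat)
    \<Rightarrow> (nat \<Rightarrow> real) \<Rightarrow> real \<Rightarrow> real \<Rightarrow> bool" where
  "consistent_with M S A E s \<eta> \<Gamma> \<longleftrightarrow>
     \<Gamma> > 0 \<and> (\<forall>N\<ge>1. s N > 0) \<and>
     (\<forall>\<epsilon>>0.
       (\<lambda>N. measure (M N) {\<omega> \<in> space (M N).
          \<bar>s N * \<delta>_min (S N) (A N \<omega>) (E N \<omega>) - \<eta>\<bar> < \<epsilon>}) \<longlonglongrightarrow> 1 \<and>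
       (\<lambda>N. measure (M N) {\<omega> \<in> space (M N).
          \<bar>s N * \<delta>_max (S N) (A N \<omega>) (E N \<omega>) - \<eta>\<bar> < \<epsilon>}) \<longlonglongrightarrow> 1 \<and>
       (\<lambda>N. measure (M N) {\<omega> \<in> space (M N).
          \<bar>s N * \<Delta>_min (S N) (A N \<omega>) (E N \<omega>) - (\<eta> + \<Gamma>)\<bar> < \<epsilon>}) \<longlonglongrightarrow> 1 \<and>
       (\<lambda>N. measure (M N) {\<omega> \<in> space (M N).
          \<bar>s N * \<Delta>_max (S N) (A N \<omega>) (E N \<omega>) - (\<eta> + \<Gamma>)\<bar> < \<epsilon>}) \<longlonglongrightarrow> 1)"

definition universal_local_structural_consistency ::
  "(nat \<Rightarrow> 'a measure) \<Rightarrow> (nat \<Rightarrow> nat set) \<Rightarrow> (nat \<Rightarrow> 'a \<Rightarrow> rmat) \<Rightarrow> (nat \<Rightarrow> 'a \<Rightarrow> rmat) \<Rightarrow> bool"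
  where
  "universal_local_structural_consistency M S A E \<longleftrightarrow> (\<exists>s \<eta> \<Gamma>. consistent_with M S A E s \<eta> \<Gamma>)"

text \<open>
  In the clustering algorithm \<open>es\<close> lists the off-diagonal pairs by ascending entries,
  so that \<open>v\<^sub>j = m (es ! (j - 1))\<close>, and a split \<open>j\<close> puts \<open>take j es\<close> into
  the lower and \<open>drop j es\<close> into the upper cluster. Ties are resolved by two parameters: equal
  entries stay in the order in which they occur in \<open>ps\<close>, an enumeration of the off-diagonal
  pairs (\<open>sort_key\<close> is stable), and \<open>pick\<close> chooses among several maximizing splits.
\<close>

definition centroid :: "rmat \<Rightarrow> (nat \<times> nat) list \<Rightarrow> real" where
  "centroid m es = sum_list (map m es) / real (length es)"

definition centroid_gap :: "rmat \<Rightarrow> (nat \<times> nat) list \<Rightarrow> nat \<Rightarrow> real" where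
  "centroid_gap m es j = centroid m (drop j es) - centroid m (take j es)"

definition admissible :: "rmat \<Rightarrow> (nat \<times> nat) list \<Rightarrow> nat \<Rightarrow> bool" where
  "admissible m es j \<longleftrightarrow> 1 \<le> j \<and> j < length es \<and>
     m (es ! (j - 1)) \<le> (centroid m (take j es) + centroid m (drop j es)) / 2 \<and>
     (centroid m (take j es) + centroid m (drop j es)) / 2 \<le> m (es ! j)"

definition optimal_splits :: "rmat \<Rightarrow> (nat \<times> nat) list \<Rightarrow> nat set" where
  "optimal_splits m es =
     {j. admissible m es j \<and> (\<forall>j'. admissible m es j' \<longrightarrow> centroid_gap m es j' \<le> centroid_gap m es j)}"

definition clu :: "(nat \<times> nat) list \<Rightarrow> (nat set \<Rightarrow> nat) \<Rightarrow> nat set \<Rightarrow> rmat \<Rightarrow> rmat" where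
  "clu ps pick S m =
     (let es = sort_key m ps; jstar = pick (optimal_splits m es)
      in (\<lambda>(i, j) \<in> S \<times> S. of_bool (i \<noteq> j \<and> (i, j) \<in> set (drop jstar es))))"

end

theory Submission
  imports Defs
begin

text \<open>
  With probability tending to one, the scaled entries of the limiting estimator lie within
  \<open>\<Gamma>/14\<close> of \<open>\<eta>\<close> at the disconnected pairs and of \<open>\<eta> + \<Gamma>\<close> at the
  connected ones; for each \<open>N\<close>, a sufficiently large sample size adds an error of at most
  another \<open>\<Gamma>/14\<close>, up to an event of probability at most \<open>1/N\<close>. The entries then form two
  groups of radius \<open>r = \<Gamma>/7\<close> whose centres have distance \<open>\<Gamma> > 6r\<close>. The split between
  the groups is admissible and its centroids differ by at least \<open>\<Gamma> - 2r > 4r\<close>. A split inside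
  a group is only admissible if the midpoint of its centroids lies within \<open>r\<close> of the centre of that
  group; since one centroid does too, the centroids differ by at most \<open>4r\<close>. Hence the algorithm
  selects the true split, whatever the relative sizes of the two groups.
\<close>

section \<open>Clustering two separated groups\<close>

lemma centroid_le:
  assumes "es \<noteq> []" "\<And>e. e \<in> set es \<Longrightarrow> m e \<le> c"
  shows "centroid m es \<le> c"
proof -
  have "sum_list (map m es) \<le> sum_list (map (\<lambda>_. c) es)"
    by (rule sum_list_mono) (use assms in auto)
  then show ?thesis
    using assms(1) by (simp add: centroid_def sum_list_triv divide_le_eq mult.commute)
qed

lemma le_centroid:
  assumes "es \<noteq> []" "\<And>e. e \<in> set es \<Longrightarrow> c \<le> m e"
  shows "c \<le> centroid m es"
proof -
  have "sum_list (map (\<lambda>_. c) es) \<le> sum_list (map m es)"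
    by (rule sum_list_mono) (use assms in auto)
  then show ?thesis
    using assms(1) by (simp add: centroid_def sum_list_triv le_divide_eq mult.commute)
qed

text \<open>The split at the group boundary has centroid gap at least \<open>b - a - 2 * r\<close>,
  which exceeds \<open>4 * r\<close>, and every other admissible split stays at or below
  \<open>4 * r\<close>. Having a single maximizer makes the choice among maximizing splits
  immaterial.\<close>

lemma optimal_splits_separated:
  fixes a b r :: real
  assumes k: "1 \<le> k" "k < length es"
    and lo: "\<And>e. e \<in> set (take k es) \<Longrightarrow> \<bar>m e - a\<bar> \<le> r"
    and hi: "\<And>e. e \<in> set (drop k es) \<Longrightarrow> \<bar>m e - b\<bar> \<le> r"
    and sep: "6 * r < b - a"
  shows "optimal_splits m es = {k}"
proof -
  have lo': "a - r \<le> m e \<and> m e \<le> a + r" if "e \<in> set (take k es)" for e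
    using lo[OF that] by linarith
  have hi': "b - r \<le> m e \<and> m e \<le> b + r" if "e \<in> set (drop k es)" for e
    using hi[OF that] by linarith
  have nth_lo: "es ! i \<in> set (take k es)" if "i < k" for i
    using that k by (auto simp: in_set_conv_nth intro!: exI[of _ i])
  have nth_hi: "es ! i \<in> set (drop k es)" if "k \<le> i" "i < length es" for i
    using that k by (auto simp: in_set_conv_nth intro!: exI[of _ "i - k"])
  have c0k: "a - r \<le> centroid m (take k es)" "centroid m (take k es) \<le> a + r"
    using k lo' by (auto intro!: le_centroid centroid_le)
  have c1k: "b - r \<le> centroid m (drop k es)" "centroid m (drop k es) \<le> b + r"
    using k hi' by (auto intro!: le_centroid centroid_le)
  have "0 \<le> r" using lo[OF nth_lo[of 0]] k by simp
  \<comment> \<open>The midpoint of the centroids is within \<open>r\<close> of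
    \<open>(a + b) / 2\<close>; both groups stay on their own side of it because
    \<open>4 * r < b - a\<close>.\<close>
  have adm: "admissible m es k"
    using k lo'[OF nth_lo[of "k - 1"]] hi'[OF nth_hi[of k]] c0k c1k sep \<open>0 \<le> r\<close>
    unfolding admissible_def by auto
  have less: "centroid_gap m es j < centroid_gap m es k"
    if j: "admissible m es j" and "j \<noteq> k" for j
  proof -
    have jl: "1 \<le> j" "j < length es"
      and ml: "2 * m (es ! (j - 1)) \<le> centroid m (take j es) + centroid m (drop j es)"
      and mh: "centroid m (take j es) + centroid m (drop j es) \<le> 2 * m (es ! j)"
      using j by (auto simp: admissible_def)
    have "centroid_gap m es j \<le> 4 * r"
    proof (cases "j < k")
      case True
      \<comment> \<open>Entry \<open>es ! j\<close> still belongs to the lower group, so the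
        midpoint is at most \<open>a + r\<close>. The gap is twice the distance from the lower
        centroid to the midpoint.\<close>
      have "set (take j es) \<subseteq> set (take k es)"
        using True by (intro set_take_subset_set_take) simp
      then have "a - r \<le> centroid m (take j es)"
        using jl lo' by (intro le_centroid) auto
      then show ?thesis
        using mh lo'[OF nth_lo[OF True]] unfolding centroid_gap_def by linarith
    next
      case False
      \<comment> \<open>Mirror image: since \<open>j > k\<close>, the entry
        \<open>es ! (j - 1)\<close> already lies in the upper group and bounds the midpoint from
        below by \<open>b - r\<close>.\<close>
      have "set (drop j es) \<subseteq> set (drop k es)"
        using False by (intro set_drop_subset_set_drop) simp
      then have "centroid m (drop j es) \<le> b + r"
        using jl hi' by (intro centroid_le) auto
      moreover have "b - r \<le> m (es ! (j - 1))"
        using False \<open>j \<noteq> k\<close> jl hi'[OF nth_hi[of "j - 1"]] by auto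
      ultimately show ?thesis
        using ml unfolding centroid_gap_def by linarith
    qed
    then show ?thesis
      using c0k c1k sep unfolding centroid_gap_def by linarith
  qed
  show ?thesis
    unfolding optimal_splits_def using adm less by (fastforce simp: not_le[symmetric])
qed

text \<open>In a sorted list the elements with key at most \<open>t\<close> form a prefix.
  Describing the split by a threshold keeps it independent of how ties are ordered.\<close>

lemma sorted_threshold_split:
  fixes m :: "'b \<Rightarrow> 'c :: linorder"
  assumes "sorted (map m es)"
  shows "\<exists>k\<le>length es. set (take k es) = {e \<in> set es. m e \<le> t} \<and>
    set (drop k es) = {e \<in> set es. \<not> m e \<le> t}"
  using assms
proof (induction es)
  case Nil
  then show ?case by simp
next
  case (Cons z es)
  show ?case
  proof (cases "m z \<le> t")
    case True
    obtain k where "k \<le> length es" "set (take k es) = {e \<in> set es. m e \<le> t}"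
      "set (drop k es) = {e \<in> set es. \<not> m e \<le> t}"
      using Cons by auto
    then show ?thesis
      using True by (intro exI[of _ "Suc k"]) auto
  next
    case False
    then show ?thesis
      using Cons.prems by (intro exI[of _ 0]) (auto dest: order_trans)
  qed
qed

lemma clu_separated:
  fixes a b r :: real
  assumes ps: "set ps = offdiag S"
    and pick: "\<And>J. J \<noteq> {} \<Longrightarrow> pick J \<in> J"
    and A_nonneg: "\<And>e. e \<in> offdiag S \<Longrightarrow> 0 \<le> A e"
    and ne: "disconnected_pairs S A \<noteq> {}" "connected_pairs S A \<noteq> {}"
    and lo: "\<And>e. e \<in> disconnected_pairs S A \<Longrightarrow> \<bar>m e - a\<bar> \<le> r"
    and hi: "\<And>e. e \<in> connected_pairs S A \<Longrightarrow> \<bar>m e - b\<bar> \<le> r"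
    and sep: "6 * r < b - a"
  shows "clu ps pick S m = support_graph S (submat S A)"
proof -
  define es where "es = sort_key m ps"
  have set_es: "set es = offdiag S" by (simp add: es_def ps)
  have "sorted (map m es)" by (simp add: es_def)
  obtain e0 where "e0 \<in> disconnected_pairs S A" using ne by auto
  then have "0 \<le> r" using lo[of e0] by linarith
  obtain k where k: "k \<le> length es" "set (take k es) = {e \<in> set es. m e \<le> a + r}"
    "set (drop k es) = {e \<in> set es. \<not> m e \<le> a + r}"
    using sorted_threshold_split[OF \<open>sorted (map m es)\<close>, of "a + r"] by blast
  \<comment> \<open>The threshold \<open>a + r\<close> separates the groups: an entry at a connected
    pair is at least \<open>b - r > a + 5 * r\<close>.\<close>
  have lo_iff: "m e \<le> a + r \<longleftrightarrow> A e = 0" if "e \<in> offdiag S" for e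
  proof (cases "A e = 0")
    case True
    then show ?thesis using lo[of e] that by (auto simp: disconnected_pairs_def)
  next
    case False
    then have "e \<in> connected_pairs S A"
      using that A_nonneg[OF that] by (auto simp: connected_pairs_def)
    then show ?thesis using hi[of e] sep \<open>0 \<le> r\<close> False by auto
  qed
  have take_k: "set (take k es) = disconnected_pairs S A"
    using k(2) set_es lo_iff by (auto simp: disconnected_pairs_def)
  have drop_k: "set (drop k es) = connected_pairs S A"
    using k(3) set_es lo_iff A_nonneg by (force simp: connected_pairs_def)
  have "k \<noteq> 0" "k < length es"
    using take_k drop_k ne k(1) by (auto simp: not_less[symmetric] intro!: Suc_leI)
  then have "optimal_splits m es = {k}"
    using take_k drop_k lo hi sep by (intro optimal_splits_separated[where a = a and b = b and r = r]) auto
  then have "pick (optimal_splits m es) = k" using pick[of "{k}"] by simp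
  then have "clu ps pick S m = (\<lambda>(i, j) \<in> S \<times> S. of_bool (i \<noteq> j \<and> (i, j) \<in> connected_pairs S A))"
    by (simp add: clu_def es_def[symmetric] drop_k Let_def)
  also have "\<dots> = support_graph S (submat S A)"
    by (auto simp: support_graph_def submat_def connected_pairs_def offdiag_def restrict_def fun_eq_iff)
  finally show ?thesis .
qed

section \<open>Measurability\<close>

text \<open>For a fixed list, each insertion step branches on a comparison of two real random
  variables.\<close>

lemma measurable_insort_key:
  fixes E :: "'a \<Rightarrow> 'b \<Rightarrow> real"
  assumes E [measurable]: "\<And>e. (\<lambda>\<omega>. E \<omega> e) \<in> borel_measurable M"
  shows "(\<lambda>\<omega>. insort_key (E \<omega>) z zs) \<in> measurable M (count_space UNIV)"
proof (induction zs)
  case Nil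
  then show ?case by simp
next
  case (Cons w zs)
  have [measurable]: "(\<lambda>\<omega>. w # insort_key (E \<omega>) z zs) \<in> measurable M (count_space UNIV)"
    by (rule measurable_compose[OF Cons]) simp
  show ?case
    unfolding insort_key.simps by (rule measurable_If) measurable
qed

lemma measurable_sort_key:
  fixes E :: "'a \<Rightarrow> 'b :: countable \<Rightarrow> real"
  assumes E [measurable]: "\<And>e. (\<lambda>\<omega>. E \<omega> e) \<in> borel_measurable M"
  shows "(\<lambda>\<omega>. sort_key (E \<omega>) zs) \<in> measurable M (count_space UNIV)"
proof (induction zs)
  case Nil
  then show ?case by simp
next
  case (Cons w zs)
  \<comment> \<open>The list inserted into is itself random, but lists over a countable type are
    countably many, so the fixed-list case suffices.\<close>
  have "(\<lambda>\<omega>. insort_key (E \<omega>) w (sort_key (E \<omega>) zs)) \<in> measurable M (count_space UNIV)"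
    by (rule measurable_compose_countable[OF measurable_insort_key[OF E] Cons])
  then show ?case by simp
qed

lemma borel_measurable_centroid:
  assumes E [measurable]: "\<And>e. (\<lambda>\<omega>. E \<omega> e) \<in> borel_measurable M"
  shows "(\<lambda>\<omega>. centroid (E \<omega>) es) \<in> borel_measurable M"
proof -
  have "(\<lambda>\<omega>. sum_list (map (E \<omega>) es)) \<in> borel_measurable M"
    by (induction es) auto
  then show ?thesis unfolding centroid_def by simp
qed

lemma measurable_optimal_splits:
  assumes E [measurable]: "\<And>e. (\<lambda>\<omega>. E \<omega> e) \<in> borel_measurable M"
  shows "Measurable.pred M (\<lambda>\<omega>. optimal_splits (E \<omega>) es = J)"
proof -
  have [measurable]: "Measurable.pred M (\<lambda>\<omega>. admissible (E \<omega>) es j)" for j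
    using borel_measurable_centroid[OF E] unfolding admissible_def by measurable
  have [measurable]: "Measurable.pred M (\<lambda>\<omega>. j \<in> optimal_splits (E \<omega>) es)" for j
    using borel_measurable_centroid[OF E]
    unfolding optimal_splits_def mem_Collect_eq centroid_gap_def by measurable
  show ?thesis unfolding set_eq_iff by measurable
qed

text \<open>Once the sorted list and the set of optimal splits are fixed, the output is constant,
  whatever function \<open>pick\<close> is. The event is thus a countable union over lists and, for
  each list, a finite union over sets of splits; the bound \<open>length es\<close> on the splits
  avoids ranging over all sets of naturals.\<close>

lemma measurable_clu_eq:
  assumes E [measurable]: "\<And>e. (\<lambda>\<omega>. E \<omega> e) \<in> borel_measurable M"
  shows "Measurable.pred M (\<lambda>\<omega>. clu ps pick S (E \<omega>) = G)"
proof -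
  let ?C = "\<lambda>es J. (\<lambda>(i, j) \<in> S \<times> S. of_bool (i \<noteq> j \<and> (i, j) \<in> set (drop (pick J) es)))"
  have sort: "(\<lambda>\<omega>. sort_key (E \<omega>) ps) \<in> measurable M (count_space UNIV)"
    by (rule measurable_sort_key[OF E])
  have eq: "clu ps pick S (E \<omega>) = G \<longleftrightarrow>
      (\<exists>es. sort_key (E \<omega>) ps = es \<and>
         (\<exists>J\<in>{J. J \<subseteq> {..<length es}}. optimal_splits (E \<omega>) es = J \<and> ?C es J = G))" for \<omega>
  proof -
    have "optimal_splits (E \<omega>) es \<subseteq> {..<length es}" for es
      by (auto simp: optimal_splits_def admissible_def)
    then show ?thesis by (auto simp: clu_def Let_def)
  qed
  have "Measurable.pred M (\<lambda>\<omega>. sort_key (E \<omega>) ps = es)" for es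
    using measurable_sets[OF sort, of "{es}"]
    by (simp add: pred_def vimage_def Int_def conj_commute)
  then show ?thesis
    unfolding eq
    by (intro pred_intros_countable(2) pred_intros_finite(4) pred_intros_logic(3)
        measurable_optimal_splits E measurable_const) auto
qed

text \<open>The fixed element \<open>c\<close> keeps the maximum nonempty, so the induction can
  start at the empty index set; \<open>max_norm\<close> has this form with
  \<open>c = 0\<close>.\<close>

lemma borel_measurable_Max_insert:
  fixes F :: "'i \<Rightarrow> 'a \<Rightarrow> real"
  assumes "finite I" "\<And>i. i \<in> I \<Longrightarrow> F i \<in> borel_measurable M"
  shows "(\<lambda>\<omega>. Max (insert c ((\<lambda>i. F i \<omega>) ` I))) \<in> borel_measurable M"
  using assms
proof (induction I)
  case empty
  then show ?case by simp
next
  case (insert i I)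
  then have [measurable]: "F i \<in> borel_measurable M"
    "(\<lambda>\<omega>. Max (insert c ((\<lambda>i. F i \<omega>) ` I))) \<in> borel_measurable M"
    by auto
  have "Max (insert c ((\<lambda>i. F i \<omega>) ` insert i I)) =
      max (F i \<omega>) (Max (insert c ((\<lambda>i. F i \<omega>) ` I)))" for \<omega>
    using insert.hyps by (subst Max_insert[symmetric]) (auto simp: insert_commute)
  then show ?case by simp
qed

section \<open>Random variables of the diffusion network\<close>

context diffusion_network
begin

text \<open>
  The adjacency matrix is a random variable with finitely many values, so that every function of
  it, measurable or not, is a random variable.
\<close>

lemma measurable_adjacency: "adjacency N g \<in> measurable M (count_space UNIV)"
proof -
  let ?I = "{1..N} \<times> {1..N}"
  let ?T = "PiE ?I (\<lambda>_. {0, 1 :: real})"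
  have g: "g i j \<in> measurable M (count_space UNIV)" if "1 \<le> i" "i < j" "j \<le> N" for i j
  proof -
    have "\<forall>e\<in>{(i, j). 1 \<le> i \<and> i < j \<and> j \<le> N}.
        (\<lambda>(i, j). g i j) e \<in> measurable M (count_space UNIV)"
      using edges_indep unfolding indep_vars_def by (rule conjunct1)
    from bspec[OF this, of "(i, j)"] that show ?thesis by simp
  qed
  have T: "adjacency N g \<omega> \<in> ?T" for \<omega>
    by (auto simp: adjacency_def PiE_iff extensional_def)
  have pt: "{\<omega> \<in> space M. adjacency N g \<omega> = B} \<in> sets M" if "B \<in> ?T" for B
  proof -
    have eq: "adjacency N g \<omega> = B \<longleftrightarrow> (\<forall>ij\<in>?I. adjacency N g \<omega> ij = B ij)" for \<omega>
      using PiE_ext[OF T that, of \<omega>] by metis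
    have "Measurable.pred M (\<lambda>\<omega>. adjacency N g \<omega> ij = B ij)" if "ij \<in> ?I" for ij
    proof -
      obtain i j where ij: "ij = (i, j)" "i \<in> {1..N}" "j \<in> {1..N}" using \<open>ij \<in> ?I\<close> by (rule SigmaE)
      show ?thesis
      proof (cases "i = j")
        case True
        then show ?thesis using ij by (simp add: adjacency_def)
      next
        case False
        then have "g (min i j) (max i j) \<in> measurable M (count_space UNIV)"
          using ij by (intro g) auto
        then show ?thesis using ij False by (simp add: adjacency_def of_bool_def)
      qed
    qed
    then have "Measurable.pred M (\<lambda>\<omega>. \<forall>ij\<in>?I. adjacency N g \<omega> ij = B ij)"
      by (intro pred_intros_finite) auto
    then show ?thesis unfolding eq by (simp add: pred_def)
  qed
  have fin: "finite ?T" by (intro finite_PiE) auto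
  have "adjacency N g -` X \<inter> space M \<in> sets M" for X
  proof -
    have "adjacency N g -` X \<inter> space M = (\<Union>B\<in>X \<inter> ?T. {\<omega> \<in> space M. adjacency N g \<omega> = B})"
      using T by auto
    also have "\<dots> \<in> sets M"
      using fin pt by (intro sets.finite_UN) auto
    finally show ?thesis .
  qed
  then show ?thesis by (intro measurableI) auto
qed

text \<open>On the sample space \<open>A\<close> is a function of the adjacency matrix, whose values
  carry the discrete sigma-algebra. This covers the limiting estimator, the margins and the support
  graph at once.\<close>

lemma measurable_fun_of_A: "(\<lambda>\<omega>. F (A \<omega>)) \<in> measurable M L"
  if "range F \<subseteq> space L"
proof -
  have "(\<lambda>\<omega>. F (\<pi> (adjacency N g \<omega>))) \<in> measurable M L"
    by (rule measurable_compose[OF measurable_adjacency]) (use that in auto)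
  then show ?thesis
    by (rule measurable_cong[THEN iffD1, rotated]) (simp add: combination)
qed

lemma pred_of_A: "{\<omega> \<in> space M. P (A \<omega>)} \<in> events"
  using measurable_fun_of_A[of P "count_space UNIV"] by (simp add: pred_def)

lemma borel_measurable_of_A: "(\<lambda>\<omega>. F (A \<omega>) :: real) \<in> borel_measurable M"
  by (rule measurable_fun_of_A) simp

lemma borel_measurable_y: "i \<in> {1..N} \<Longrightarrow> y i n \<in> borel_measurable M"
proof (induction n arbitrary: i)
  case 0
  then show ?case by (rule y_initial)
next
  case (Suc n)
  have x [measurable]: "x i (Suc n) \<in> borel_measurable M"
  proof -
    have "\<forall>e\<in>{1..N} \<times> {1..}. (\<lambda>(i, n). x i n) e \<in> borel_measurable M"
      using x_indep unfolding indep_vars_def by (rule conjunct1)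
    from bspec[OF this, of "(i, Suc n)"] Suc.prems show ?thesis by simp
  qed
  have [measurable]: "(\<lambda>\<omega>. A \<omega> e) \<in> borel_measurable M" for e
    by (rule borel_measurable_of_A)
  have "(\<lambda>\<omega>. (\<Sum>j = 1..N. A \<omega> (i, j) * y j n \<omega>) + \<sigma> * x i (Suc n) \<omega>) \<in> borel_measurable M"
    using Suc.IH by (intro borel_measurable_add borel_measurable_sum borel_measurable_times) auto
  then show ?case
    by (rule measurable_cong[THEN iffD1, rotated]) (use Suc.prems in \<open>simp add: y_step\<close>)
qed

lemma borel_measurable_estimate:
  assumes S: "S \<subseteq> {1..N}" and f: "matrix_estimator S n f"
  shows "(\<lambda>\<omega>. f (data_matrix S y n \<omega>) e) \<in> borel_measurable M"
proof -
  have "data_matrix S y n \<in> measurable M (Pi\<^sub>M (S \<times> {1..n}) (\<lambda>_. borel))"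
    unfolding data_matrix_def
    by (rule measurable_restrict) (use S in \<open>auto intro!: borel_measurable_y\<close>)
  then have est: "(\<lambda>\<omega>. f (data_matrix S y n \<omega>)) \<in> measurable M (Pi\<^sub>M (S \<times> S) (\<lambda>_. borel))"
    using f unfolding matrix_estimator_def by (rule measurable_compose)
  show ?thesis
  proof (cases "e \<in> S \<times> S")
    case True
    show ?thesis
      by (rule measurable_compose[OF est measurable_component_singleton[OF True]])
  next
    case False
    \<comment> \<open>Elements of the product space are extensional, so outside
      \<open>S \<times> S\<close> the estimate is constant. The measurability lemmas for
      \<open>clu\<close> ask for every index \<open>e\<close>.\<close>
    have "f (data_matrix S y n \<omega>) e = undefined" if "\<omega> \<in> space M" for \<omega>
      using measurable_space[OF est that] False by (intro PiE_arb) (auto simp: space_PiM)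
    then show ?thesis
      by (subst measurable_cong[of _ _ "\<lambda>_. undefined"]) auto
  qed
qed

end

section \<open>Exact recovery\<close>

lemma abs_le_max_norm:
  assumes "finite S" "e \<in> S \<times> S"
  shows "\<bar>B e\<bar> \<le> max_norm S B"
  using assms unfolding max_norm_def by (intro Max_ge) auto

text \<open>Scaling by a positive \<open>s\<close> preserves order, so the scaled entry lies between
  the two scaled margins.\<close>

lemma margins_imp_close_disconnected:
  assumes fin: "finite S" and e: "e \<in> disconnected_pairs S A"
    and "\<bar>s * \<delta>_min S A E - \<eta>\<bar> < \<epsilon>" "\<bar>s * \<delta>_max S A E - \<eta>\<bar> < \<epsilon>" "0 < s"
  shows "\<bar>s * E e - \<eta>\<bar> < \<epsilon>"
proof -
  have "finite (disconnected_pairs S A)"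
    by (rule finite_subset[of _ "S \<times> S"]) (auto simp: disconnected_pairs_def offdiag_def fin)
  then have "s * \<delta>_min S A E \<le> s * E e" "s * E e \<le> s * \<delta>_max S A E"
    using e \<open>0 < s\<close> by (auto simp: \<delta>_min_def \<delta>_max_def)
  then show ?thesis using assms by linarith
qed

text \<open>The same sandwich for the upper group; here \<open>\<eta>\<close> is just a centre and
  is later instantiated with \<open>\<eta> + \<Gamma>\<close>.\<close>

lemma margins_imp_close_connected:
  assumes fin: "finite S" and e: "e \<in> connected_pairs S A"
    and "\<bar>s * \<Delta>_min S A E - \<eta>\<bar> < \<epsilon>" "\<bar>s * \<Delta>_max S A E - \<eta>\<bar> < \<epsilon>" "0 < s"
  shows "\<bar>s * E e - \<eta>\<bar> < \<epsilon>"
proof -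
  have "finite (connected_pairs S A)"
    by (rule finite_subset[of _ "S \<times> S"]) (auto simp: connected_pairs_def offdiag_def fin)
  then have "s * \<Delta>_min S A E \<le> s * E e" "s * E e \<le> s * \<Delta>_max S A E"
    using e \<open>0 < s\<close> by (auto simp: \<Delta>_min_def \<Delta>_max_def)
  then show ?thesis using assms by linarith
qed

text \<open>The deterministic core: the conditions \<open>ndeg\<close>, \<open>margins\<close> and
  \<open>err\<close> describe the events shown later to have probability tending to one. Clustering
  acts on unscaled entries, hence the divisions by \<open>s\<close>.\<close>

lemma clu_recovers_support_graph:
  fixes A E Ehat :: rmat
  assumes ps: "set ps = offdiag S"
    and pick: "\<And>J. J \<noteq> {} \<Longrightarrow> pick J \<in> J"
    and fin: "finite S"
    and A_nonneg: "\<And>e. e \<in> offdiag S \<Longrightarrow> 0 \<le> A e"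
    and s: "0 < s" and \<Gamma>: "0 < \<Gamma>"
    and ndeg: "connected_pairs S A \<noteq> offdiag S" "disconnected_pairs S A \<noteq> offdiag S"
    and margins: "\<bar>s * \<delta>_min S A E - \<eta>\<bar> < \<Gamma> / 14" "\<bar>s * \<delta>_max S A E - \<eta>\<bar> < \<Gamma> / 14"
      "\<bar>s * \<Delta>_min S A E - (\<eta> + \<Gamma>)\<bar> < \<Gamma> / 14" "\<bar>s * \<Delta>_max S A E - (\<eta> + \<Gamma>)\<bar> < \<Gamma> / 14"
    and err: "max_norm S (\<lambda>e. Ehat e - E e) \<le> \<Gamma> / 14 / s"
  shows "clu ps pick S Ehat = support_graph S (submat S A)"
proof (rule clu_separated[where a = "\<eta> / s" and b = "(\<eta> + \<Gamma>) / s" and r = "\<Gamma> / 7 / s"])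
  \<comment> \<open>One \<open>\<Gamma> / 14 / s\<close> comes from the margins and one from the
    estimation error.\<close>
  have close: "\<bar>Ehat e - c / s\<bar> \<le> \<Gamma> / 7 / s" if "\<bar>s * E e - c\<bar> < \<Gamma> / 14" "e \<in> offdiag S" for e c
  proof -
    have "\<bar>Ehat e - E e\<bar> \<le> \<Gamma> / 14 / s"
      using abs_le_max_norm[OF fin, of e "\<lambda>e. Ehat e - E e"] that err by (auto simp: offdiag_def)
    moreover have "\<bar>E e - c / s\<bar> = \<bar>s * E e - c\<bar> / s"
      using s by (simp add: field_simps abs_mult flip: abs_of_pos)
    then have "\<bar>E e - c / s\<bar> \<le> \<Gamma> / 14 / s"
      using divide_right_mono[OF less_imp_le[OF that(1)], of s] s by simp
    moreover have "\<Gamma> / 7 / s = \<Gamma> / 14 / s + \<Gamma> / 14 / s" by simp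
    ultimately show ?thesis by linarith
  qed
  show "\<bar>Ehat e - \<eta> / s\<bar> \<le> \<Gamma> / 7 / s" if "e \<in> disconnected_pairs S A" for e
    using margins_imp_close_disconnected[OF fin that margins(1,2) s] that
    by (intro close) (auto simp: disconnected_pairs_def)
  show "\<bar>Ehat e - (\<eta> + \<Gamma>) / s\<bar> \<le> \<Gamma> / 7 / s" if "e \<in> connected_pairs S A" for e
    using margins_imp_close_connected[OF fin that margins(3,4) s] that
    by (intro close) (auto simp: connected_pairs_def)
  show "6 * (\<Gamma> / 7 / s) < (\<eta> + \<Gamma>) / s - \<eta> / s"
    using s \<Gamma> by (simp add: field_simps)
  \<comment> \<open>By nonnegativity every pair is connected or disconnected, so an empty class
    would make the other one all of \<open>offdiag S\<close>.\<close>
  show "disconnected_pairs S A \<noteq> {}" "connected_pairs S A \<noteq> {}"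
    using ndeg A_nonneg by (force simp: connected_pairs_def disconnected_pairs_def)+
qed (use ps pick A_nonneg in auto)

section \<open>Events with probability tending to one\<close>

lemma measure_Int_tendsto_1:
  fixes M :: "nat \<Rightarrow> 'a measure"
  assumes M: "\<And>N. N \<ge> 1 \<Longrightarrow> prob_space (M N)"
    and ev: "\<And>N. N \<ge> 1 \<Longrightarrow> X N \<in> sets (M N)" "\<And>N. N \<ge> 1 \<Longrightarrow> Y N \<in> sets (M N)"
    and lim: "(\<lambda>N. measure (M N) (X N)) \<longlonglongrightarrow> 1" "(\<lambda>N. measure (M N) (Y N)) \<longlonglongrightarrow> 1"
  shows "(\<lambda>N. measure (M N) (X N \<inter> Y N)) \<longlonglongrightarrow> 1"
proof (rule tendsto_sandwich)
  \<comment> \<open>Inclusion-exclusion, with the probability of the union bounded by one.\<close>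
  show "\<forall>\<^sub>F N in sequentially. measure (M N) (X N) + measure (M N) (Y N) - 1 \<le> measure (M N) (X N \<inter> Y N)"
    using eventually_ge_at_top[of 1]
  proof eventually_elim
    case (elim N)
    interpret prob_space "M N" by (rule M[OF elim])
    have "prob (X N \<union> Y N) = prob (X N) + prob (Y N) - prob (X N \<inter> Y N)"
      using ev[OF elim] measure_Un3[of "X N" "M N" "Y N"] by (simp add: fmeasurable_eq_sets)
    then show ?case using prob_le_1[of "X N \<union> Y N"] by linarith
  qed
  show "\<forall>\<^sub>F N in sequentially. measure (M N) (X N \<inter> Y N) \<le> 1"
    using eventually_ge_at_top[of 1] by eventually_elim (simp add: M prob_space.prob_le_1)
  show "(\<lambda>N. measure (M N) (X N) + measure (M N) (Y N) - 1) \<longlonglongrightarrow> 1"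
    using tendsto_diff[OF tendsto_add[OF lim] tendsto_const[of 1]] by simp
qed simp

lemma measure_Compl_tendsto_1:
  fixes M :: "nat \<Rightarrow> 'a measure"
  assumes M: "\<And>N. N \<ge> 1 \<Longrightarrow> prob_space (M N)"
    and ev: "\<And>N. N \<ge> 1 \<Longrightarrow> {\<omega> \<in> space (M N). P N \<omega>} \<in> sets (M N)"
    and lim: "(\<lambda>N. measure (M N) {\<omega> \<in> space (M N). P N \<omega>}) \<longlonglongrightarrow> 0"
  shows "(\<lambda>N. measure (M N) {\<omega> \<in> space (M N). \<not> P N \<omega>}) \<longlonglongrightarrow> 1"
proof -
  have "(\<lambda>N. 1 - measure (M N) {\<omega> \<in> space (M N). P N \<omega>}) \<longlonglongrightarrow> 1"
    using tendsto_diff[OF tendsto_const[of 1] lim] by simp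
  moreover have "\<forall>\<^sub>F N in sequentially. 1 - measure (M N) {\<omega> \<in> space (M N). P N \<omega>} =
      measure (M N) {\<omega> \<in> space (M N). \<not> P N \<omega>}"
    using eventually_ge_at_top[of 1]
    by eventually_elim (simp add: M ev prob_space.prob_neg)
  ultimately show ?thesis by (rule Lim_transform_eventually)
qed

section \<open>Choice of the scaling law and passage to the limit\<close>

theorem theorem1:
  fixes M :: "nat \<Rightarrow> 'a measure"
    and p :: "nat \<Rightarrow> real"
    and g :: "nat \<Rightarrow> nat \<Rightarrow> nat \<Rightarrow> 'a \<Rightarrow> bool"
    and \<pi> :: "nat \<Rightarrow> rmat \<Rightarrow> rmat"
    and A :: "nat \<Rightarrow> 'a \<Rightarrow> rmat"
    and \<sigma> :: real
    and x y :: "nat \<Rightarrow> nat \<Rightarrow> nat \<Rightarrow> 'a \<Rightarrow> real"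
    and S :: "nat \<Rightarrow> nat set"
    and \<xi> :: real
    and f :: "nat \<Rightarrow> nat \<Rightarrow> rmat \<Rightarrow> rmat"
    and h :: "nat \<Rightarrow> rmat \<Rightarrow> rmat"
    and ps :: "nat \<Rightarrow> (nat \<times> nat) list"
    and pick :: "nat \<Rightarrow> nat set \<Rightarrow> nat"
  assumes model:
      "\<And>N. N \<ge> 1 \<Longrightarrow> diffusion_network (M N) N (p N) (g N) (\<pi> N) (A N) \<sigma> (x N) (y N)"
    and S_nodes: "\<And>N. N \<ge> 1 \<Longrightarrow> S N \<subseteq> {1..N}"
    and S_fraction: "(\<lambda>N. real (card (S N)) / real N) \<longlonglongrightarrow> \<xi>" "0 < \<xi>" "\<xi> < 1"
    and not_all_connected:
      "(\<lambda>N. measure (M N) {\<omega> \<in> space (M N). connected_pairs (S N) (A N \<omega>) = offdiag (S N)})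
         \<longlonglongrightarrow> 0"
    and not_all_disconnected:
      "(\<lambda>N. measure (M N) {\<omega> \<in> space (M N). disconnected_pairs (S N) (A N \<omega>) = offdiag (S N)})
         \<longlonglongrightarrow> 0"
    and estimators: "\<And>N n. N \<ge> 1 \<Longrightarrow> n \<ge> 1 \<Longrightarrow> matrix_estimator (S N) n (f N n)"
    and limiting_estimator:
      "\<And>N \<epsilon>. N \<ge> 1 \<Longrightarrow> \<epsilon> > 0 \<Longrightarrow>
         (\<lambda>n. measure (M N) {\<omega> \<in> space (M N).
            max_norm (S N) (\<lambda>ij. f N n (data_matrix (S N) (y N) n \<omega>) ij - h N (A N \<omega>) ij) > \<epsilon>})
           \<longlonglongrightarrow> 0"
    and consistency:
      "universal_local_structural_consistency M S A (\<lambda>N \<omega>. h N (A N \<omega>))"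
    and clu_order: "\<And>N. N \<ge> 1 \<Longrightarrow> distinct (ps N) \<and> set (ps N) = offdiag (S N)"
    and clu_pick: "\<And>N J. J \<noteq> {} \<Longrightarrow> pick N J \<in> J"
  shows "\<exists>n :: nat \<Rightarrow> nat. (\<forall>N. n N \<ge> 1) \<and>
    (\<lambda>N. measure (M N) {\<omega> \<in> space (M N).
       clu (ps N) (pick N) (S N) (f N (n N) (data_matrix (S N) (y N) (n N) \<omega>))
         = support_graph (S N) (submat (S N) (A N \<omega>))}) \<longlonglongrightarrow> 1"
proof -
  obtain s \<eta> \<Gamma> where \<Gamma>: "\<Gamma> > 0" and s: "\<And>N. N \<ge> 1 \<Longrightarrow> s N > 0"
    and cons: "consistent_with M S A (\<lambda>N \<omega>. h N (A N \<omega>)) s \<eta> \<Gamma>"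
    using consistency
    unfolding universal_local_structural_consistency_def consistent_with_def by blast
  have prob: "prob_space (M N)" if "N \<ge> 1" for N
    using model[OF that] by (rule diffusion_network.axioms(1))
  have fin: "finite (S N)" if "N \<ge> 1" for N
    using S_nodes[OF that] finite_subset by blast
  let ?E = "\<lambda>N n \<omega>. f N n (data_matrix (S N) (y N) n \<omega>)"
  let ?far = "\<lambda>N n \<omega>. max_norm (S N) (\<lambda>e. ?E N n \<omega> e - h N (A N \<omega>) e) > \<Gamma> / 14 / s N"
  have E: "(\<lambda>\<omega>. ?E N n \<omega> e) \<in> borel_measurable (M N)" if "N \<ge> 1" "n \<ge> 1" for N n e
    using diffusion_network.borel_measurable_estimate[OF model[OF that(1)] S_nodes[OF that(1)]
        estimators[OF that]] .
  have hA: "(\<lambda>\<omega>. h N (A N \<omega>) e) \<in> borel_measurable (M N)" if "N \<ge> 1" for N e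
    by (rule diffusion_network.borel_measurable_of_A[OF model[OF that]])
  have of_A: "{\<omega> \<in> space (M N). P (A N \<omega>)} \<in> sets (M N)" if "N \<ge> 1" for N P
    by (rule diffusion_network.pred_of_A[OF model[OF that]])
  have far: "{\<omega> \<in> space (M N). ?far N n \<omega>} \<in> sets (M N)" if N: "N \<ge> 1" and n: "n \<ge> 1" for N n
  proof -
    have "(\<lambda>\<omega>. max_norm (S N) (\<lambda>e. ?E N n \<omega> e - h N (A N \<omega>) e)) \<in> borel_measurable (M N)"
      unfolding max_norm_def using fin[OF N] E[OF N n] hA[OF N]
      by (intro borel_measurable_Max_insert) auto
    then show ?thesis by measurable
  qed
  \<comment> \<open>The convergence in \<open>n\<close> is used separately for each
    \<open>N\<close>, with a tolerance that depends on \<open>N\<close> through \<open>s N\<close>.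
    For \<open>N = 0\<close> there is no model and any positive \<open>n\<close> serves.\<close>
  have ex_n: "\<exists>n. n \<ge> 1 \<and>
      (N \<ge> 1 \<longrightarrow> measure (M N) {\<omega> \<in> space (M N). ?far N n \<omega>} < 1 / N)" for N
  proof (cases "N \<ge> 1")
    case True
    have "\<forall>\<^sub>F n in sequentially. measure (M N) {\<omega> \<in> space (M N). ?far N n \<omega>} < 1 / N"
      by (rule order_tendstoD(2)[OF limiting_estimator[OF True]]) (use \<Gamma> s True in auto)
    then have "\<forall>\<^sub>F n in sequentially. n \<ge> 1 \<and>
        measure (M N) {\<omega> \<in> space (M N). ?far N n \<omega>} < 1 / N"
      using eventually_ge_at_top[of 1] by eventually_elim simp
    then show ?thesis
      using eventually_happens'[OF sequentially_bot] by blast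
  qed auto
  obtain n where "\<forall>N. n N \<ge> 1 \<and>
      (N \<ge> 1 \<longrightarrow> measure (M N) {\<omega> \<in> space (M N). ?far N (n N) \<omega>} < 1 / N)"
    by (rule exE[OF choice[OF allI[OF ex_n]]])
  then have n: "n N \<ge> 1"
    and n_far: "N \<ge> 1 \<Longrightarrow> measure (M N) {\<omega> \<in> space (M N). ?far N (n N) \<omega>} < 1 / N" for N
    by (simp_all only:)
  let ?rec = "\<lambda>N. {\<omega> \<in> space (M N).
    clu (ps N) (pick N) (S N) (?E N (n N) \<omega>) = support_graph (S N) (submat (S N) (A N \<omega>))}"
  have rec: "?rec N \<in> sets (M N)" if N: "N \<ge> 1" for N
  proof -
    define D where "D = PiE (S N \<times> S N) (\<lambda>_. {0, 1 :: real})"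
    have "finite D" unfolding D_def using fin[OF N] by (intro finite_PiE) auto
    have D: "support_graph (S N) B \<in> D" for B
      by (auto simp: support_graph_def D_def PiE_iff extensional_def)
    \<comment> \<open>The support graph takes finitely many values, which turns the equality of two
      random graphs into a finite union of events with a fixed graph.\<close>
    have "?rec N = (\<Union>G\<in>D. {\<omega> \<in> space (M N). clu (ps N) (pick N) (S N) (?E N (n N) \<omega>) = G} \<inter>
        {\<omega> \<in> space (M N). support_graph (S N) (submat (S N) (A N \<omega>)) = G})"
      using D by auto
    also have "\<dots> \<in> sets (M N)"
      using \<open>finite D\<close> of_A[OF N] measurable_clu_eq[OF E[OF N n]]
      by (intro sets.finite_UN sets.Int) (auto simp: pred_def)
    finally show ?thesis .
  qed
  have lim_far: "(\<lambda>N. measure (M N) {\<omega> \<in> space (M N). ?far N (n N) \<omega>}) \<longlonglongrightarrow> 0"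
  proof (rule tendsto_sandwich[OF _ _ tendsto_const lim_1_over_n])
    show "\<forall>\<^sub>F N in sequentially. measure (M N) {\<omega> \<in> space (M N). ?far N (n N) \<omega>} \<le> 1 / real N"
      using eventually_ge_at_top[of 1] by eventually_elim (use n_far in \<open>simp add: less_imp_le\<close>)
  qed simp
  note cons' = cons[unfolded consistent_with_def, THEN conjunct2, THEN conjunct2,
      rule_format, of "\<Gamma> / 14"]
  have "\<Gamma> / 14 > 0" using \<Gamma> by simp
  note margins = cons'[OF this, THEN conjunct1]
    cons'[OF this, THEN conjunct2, THEN conjunct1]
    cons'[OF this, THEN conjunct2, THEN conjunct2, THEN conjunct1]
    cons'[OF this, THEN conjunct2, THEN conjunct2, THEN conjunct2]
  define near where "near N = {\<omega> \<in> space (M N). \<not> ?far N (n N) \<omega>}" for N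
  have near: "near N \<in> sets (M N)" if "N \<ge> 1" for N
    unfolding near_def using far[OF that n] by (rule sets.sets_Collect_neg)
  have lim_near: "(\<lambda>N. measure (M N) (near N)) \<longlonglongrightarrow> 1"
    unfolding near_def by (intro measure_Compl_tendsto_1 prob far n lim_far)
  \<comment> \<open>Stated as predicates of a matrix \<open>B\<close>, so that the margin events
    have the form \<open>P (A N \<omega>)\<close> and are measurable by \<open>of_A\<close>.\<close>
  define lo_min lo_max hi_min hi_max where
    "lo_min N B \<longleftrightarrow> \<bar>s N * \<delta>_min (S N) B (h N B) - \<eta>\<bar> < \<Gamma> / 14" and
    "lo_max N B \<longleftrightarrow> \<bar>s N * \<delta>_max (S N) B (h N B) - \<eta>\<bar> < \<Gamma> / 14" and
    "hi_min N B \<longleftrightarrow> \<bar>s N * \<Delta>_min (S N) B (h N B) - (\<eta> + \<Gamma>)\<bar> < \<Gamma> / 14" and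
    "hi_max N B \<longleftrightarrow> \<bar>s N * \<Delta>_max (S N) B (h N B) - (\<eta> + \<Gamma>)\<bar> < \<Gamma> / 14" for N B
  note margin_defs = lo_min_def lo_max_def hi_min_def hi_max_def
  \<comment> \<open>Four margin events, two nondegeneracy events and a small estimation error; the
    right nesting lets binary intersections be peeled off one by one.\<close>
  let ?good = "\<lambda>N. {\<omega> \<in> space (M N). lo_min N (A N \<omega>)} \<inter>
      ({\<omega> \<in> space (M N). lo_max N (A N \<omega>)} \<inter>
      ({\<omega> \<in> space (M N). hi_min N (A N \<omega>)} \<inter>
      ({\<omega> \<in> space (M N). hi_max N (A N \<omega>)} \<inter>
      ({\<omega> \<in> space (M N). \<not> connected_pairs (S N) (A N \<omega>) = offdiag (S N)} \<inter>
      ({\<omega> \<in> space (M N). \<not> disconnected_pairs (S N) (A N \<omega>) = offdiag (S N)} \<inter>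
       near N)))))"
  have not_degenerate:
    "(\<lambda>N. measure (M N) {\<omega> \<in> space (M N).
        \<not> connected_pairs (S N) (A N \<omega>) = offdiag (S N)}) \<longlonglongrightarrow> 1"
    "(\<lambda>N. measure (M N) {\<omega> \<in> space (M N).
        \<not> disconnected_pairs (S N) (A N \<omega>) = offdiag (S N)}) \<longlonglongrightarrow> 1"
    by (intro measure_Compl_tendsto_1 prob of_A not_all_connected not_all_disconnected;
        assumption)+
  have lim_good: "(\<lambda>N. measure (M N) (?good N)) \<longlonglongrightarrow> 1"
    by (intro measure_Int_tendsto_1[OF prob] margins[folded margin_defs] not_degenerate lim_near
        sets.Int near of_A[where P = "lo_min _"] of_A[where P = "lo_max _"]
        of_A[where P = "hi_min _"] of_A[where P = "hi_max _"]
        of_A[where P = "\<lambda>B. \<not> connected_pairs _ B = _"]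
        of_A[where P = "\<lambda>B. \<not> disconnected_pairs _ B = _"])
  \<comment> \<open>Recovery on the good event is purely deterministic, so its probability is a
    lower bound for that of recovery.\<close>
  have good_rec: "?good N \<subseteq> ?rec N" if N: "N \<ge> 1" for N
  proof
    fix \<omega> assume \<omega>: "\<omega> \<in> ?good N"
    have "clu (ps N) (pick N) (S N) (?E N (n N) \<omega>) = support_graph (S N) (submat (S N) (A N \<omega>))"
    proof (rule clu_recovers_support_graph[where E = "h N (A N \<omega>)" and s = "s N" and \<eta> = \<eta> and \<Gamma> = \<Gamma>])
      show "0 \<le> A N \<omega> e" if "e \<in> offdiag (S N)" for e
      proof -
        have "fst e \<in> {1..N}" "snd e \<in> {1..N}"
          using that S_nodes[OF N] by (auto simp: offdiag_def)
        moreover have "\<omega> \<in> space (M N)" using \<omega> by simp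
        ultimately show ?thesis
          using diffusion_network.A_nonneg[OF model[OF N], of \<omega> "fst e" "snd e"] by simp
      qed
    qed (use \<omega> N clu_order clu_pick fin s \<Gamma> in \<open>auto simp: near_def margin_defs not_less\<close>)
    then show "\<omega> \<in> ?rec N" using \<omega> by auto
  qed
  have "(\<lambda>N. measure (M N) (?rec N)) \<longlonglongrightarrow> 1"
  proof (rule tendsto_sandwich[OF _ _ lim_good tendsto_const])
    show "\<forall>\<^sub>F N in sequentially. measure (M N) (?good N) \<le> measure (M N) (?rec N)"
      using eventually_ge_at_top[of 1]
    proof eventually_elim
      case (elim N)
      interpret prob_space "M N" by (rule prob[OF elim])
      show ?case by (rule finite_measure_mono[OF good_rec[OF elim] rec[OF elim]])
    qed
    show "\<forall>\<^sub>F N in sequentially. measure (M N) (?rec N) \<le> 1"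
      using eventually_ge_at_top[of 1] by eventually_elim (simp add: prob prob_space.prob_le_1)
  qed
  then show ?thesis using n by (intro exI[of _ n]) auto
qed

end
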